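(* Let $G=(V,E)$ be a finite simple graph with at least one edge, and consider eigenpairs of problem (AC). (a) Every eigenvalue $\mu$ satisfies $0\le\mu\le1$. (b) Any two distinct eigenvalues differ by at least $\frac{2}{\mathrm{vol}(V)^2}$; consequently there are at most $\frac{\mathrm{vol}(V)^2}{2}+1$ distinct eigenvalues. (c) For every $A\subseteq V$, with $\vec x=\vec 1_A-\vec 1_{V\setminus A}$ and $\mu=\frac{|\partial A|}{\max\{\mathrm{vol}(A),\mathrm{vol}(V\setminus A)\}}$, $(\mu,\vec x)$ is an eigenpair. (d) If $(\mu,\vec x)$ is an eigenpair, then $\frac{I(\vec x)}{2\mathrm{vol}(V)\|\vec x\|_\infty-N(\vec x)}=\mu$; moreover $(\mu,\vec 1_{D_+(\vec x)}-\vec 1_{D_-(\vec x)})$ and $(\mu,\vec 1_{D_+(\vec x)}-\vec 1_{V\setminus D_+(\vec x)})$ are both eigenpairs.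
   Context: $V=\{1,\dots,n\}$, unit edge weights, $d_i$ degree, $\mathrm{vol}(S)=\sum_{i\in S}d_i$, $|\partial A|$ number of edges between $A$ and $V\setminus A$. $I(\vec x)=\sum_{\{i,j\}\in E}|x_i-x_j|$, $N(\vec x)=\min_{t\in\mathbb{R}}\sum_i d_i|x_i-t|$. $\mathrm{Sgn}(t)=\{1\},[-1,1],\{-1\}$ for $t>0,t=0,t<0$; $(\Delta_1\vec x)_i=\{\sum_{j:\{i,j\}\in E}z_{ij}: z_{ij}\in\mathrm{Sgn}(x_i-x_j),z_{ij}=-z_{ji}\}$. Problem (AC): $(\mu,\vec x)$, $\mu\in\mathbb{R}$, $\vec x\ne\vec0$, with $\vec 0\in\Delta_1\vec x-2\mu\,\mathrm{vol}(V)\,\partial\|\vec x\|_\infty+\mu\,\partial N(\vec x)$ ($\partial$ = convex subdifferential). $D_\pm(\vec x)=\{i:\pm x_i=\|\vec x\|_\infty\}$. *)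

theory Defs
  imports "HOL-Analysis.Analysis"
begin

text \<open>The vertex set is the whole of the finite type \<open>'n\<close>, so a graph is given by its
  set of edges, and vectors indexed by the vertices are elements of \<open>real ^ 'n\<close>.\<close>

definition simple_graph :: "'n::finite set set \<Rightarrow> bool" where
  "simple_graph E \<longleftrightarrow> (\<forall>e\<in>E. card e = 2)"

definition vertex_degree :: "'n::finite set set \<Rightarrow> 'n \<Rightarrow> nat" where
  "vertex_degree E i = card {j. {i, j} \<in> E}"

definition vol :: "'n::finite set set \<Rightarrow> 'n set \<Rightarrow> nat" where
  "vol E S = (\<Sum>i\<in>S. vertex_degree E i)"

definition edge_boundary :: "'n::finite set set \<Rightarrow> 'n set \<Rightarrow> 'n set set" where
  "edge_boundary E A = {e \<in> E. \<exists>i j. e = {i, j} \<and> i \<in> A \<and> j \<notin> A}"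

text \<open>The sum over unordered edges is taken over ordered pairs, which counts every edge twice.\<close>

definition total_variation :: "'n::finite set set \<Rightarrow> real ^ 'n \<Rightarrow> real" where
  "total_variation E x = (\<Sum>(i, j) | {i, j} \<in> E. \<bar>x $ i - x $ j\<bar>) / 2"

text \<open>The minimum over \<open>t\<close> is written as an infimum; it is attained by
  \<open>median_deviation_attained\<close> below.\<close>

definition median_deviation :: "'n::finite set set \<Rightarrow> real ^ 'n \<Rightarrow> real" where
  "median_deviation E x = (INF t. \<Sum>i\<in>UNIV. real (vertex_degree E i) * \<bar>x $ i - t\<bar>)"

definition Sgn :: "real \<Rightarrow> real set" where
  "Sgn t = (if t > 0 then {1} else if t = 0 then {-1..1} else {-1})"

text \<open>A single antisymmetric family \<open>z\<close> serves all the components simultaneously.\<close>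

definition Laplacian1 :: "'n::finite set set \<Rightarrow> real ^ 'n \<Rightarrow> (real ^ 'n) set" where
  "Laplacian1 E x =
     {(\<chi> i. \<Sum>j | {i, j} \<in> E. z i j) | z.
        \<forall>i j. {i, j} \<in> E \<longrightarrow> z i j \<in> Sgn (x $ i - x $ j) \<and> z i j = - z j i}"

definition subdifferential :: "('a::real_inner \<Rightarrow> real) \<Rightarrow> 'a \<Rightarrow> 'a set" where
  "subdifferential f x = {g. \<forall>y. f y \<ge> f x + g \<bullet> (y - x)}"

text \<open>The sum and difference of sets are Minkowski's.\<close>

definition AC_eigenpair :: "'n::finite set set \<Rightarrow> real \<Rightarrow> real ^ 'n \<Rightarrow> bool" where
  "AC_eigenpair E \<mu> x \<longleftrightarrow>
     x \<noteq> 0 \<and>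
     0 \<in> {u - (2 * \<mu> * real (vol E UNIV)) *\<^sub>R s + \<mu> *\<^sub>R v | u s v.
            u \<in> Laplacian1 E x \<and>
            s \<in> subdifferential infnorm x \<and>
            v \<in> subdifferential (median_deviation E) x}"

definition AC_eigenvalue :: "'n::finite set set \<Rightarrow> real \<Rightarrow> bool" where
  "AC_eigenvalue E \<mu> \<longleftrightarrow> (\<exists>x. AC_eigenpair E \<mu> x)"

definition D_plus :: "real ^ 'n::finite \<Rightarrow> 'n set" where
  "D_plus x = {i. x $ i = infnorm x}"

definition D_minus :: "real ^ 'n::finite \<Rightarrow> 'n set" where
  "D_minus x = {i. - x $ i = infnorm x}"

definition ind_vec :: "'n::finite set \<Rightarrow> real ^ 'n" where
  "ind_vec A = (\<chi> i. indicator A i)"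

lemma median_deviation_attained:
  fixes x :: "real ^ 'n::finite"
  shows "\<exists>t. median_deviation E x = (\<Sum>i\<in>UNIV. real (vertex_degree E i) * \<bar>x $ i - t\<bar>)
           \<and> (\<forall>s. median_deviation E x \<le> (\<Sum>i\<in>UNIV. real (vertex_degree E i) * \<bar>x $ i - s\<bar>))"
proof -
  define f where "f t = (\<Sum>i\<in>UNIV. real (vertex_degree E i) * \<bar>x $ i - t\<bar>)" for t
  define M where "M = infnorm x"
  have M: "\<bar>x $ i\<bar> \<le> M" for i
    unfolding M_def by (rule component_le_infnorm_cart)
  have M0: "0 \<le> M"
    unfolding M_def by (rule infnorm_pos_le)
  have "continuous_on {-M..M} f"
    unfolding f_def by (intro continuous_intros)
  then have "\<exists>t\<in>{-M..M}. \<forall>s\<in>{-M..M}. f t \<le> f s"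
    using M0 by (intro continuous_attains_inf) auto
  then obtain t where t: "\<And>s. s \<in> {-M..M} \<Longrightarrow> f t \<le> f s"
    by blast
  have clamp: "f (max (-M) (min M s)) \<le> f s" for s
    unfolding f_def
  proof (intro sum_mono mult_left_mono)
    fix i show "\<bar>x $ i - max (-M) (min M s)\<bar> \<le> \<bar>x $ i - s\<bar>"
      using M[of i] by (auto simp: max_def min_def abs_if split: if_splits)
  qed simp
  have min: "f t \<le> f s" for s
    using t[of "max (-M) (min M s)"] clamp[of s] M0 by (simp add: max_def min_def split: if_splits)
  have "median_deviation E x = (INF t. f t)"
    unfolding median_deviation_def f_def ..
  also have "\<dots> = f t"
    by (rule cInf_eq_minimum) (use min in auto)
  finally show ?thesis
    using min unfolding f_def by auto
qed

lemma vol_UNIV_pos: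
  assumes "simple_graph E" and "E \<noteq> {}"
  shows "0 < vol E UNIV"
proof -
  from assms(2) obtain e where e: "e \<in> E"
    by auto
  with assms(1) have "card e = 2"
    by (simp add: simple_graph_def)
  with e obtain i j where "{i, j} \<in> E"
    by (auto simp: card_2_iff)
  then have "0 < vertex_degree E i"
    unfolding vertex_degree_def by (auto simp: card_gt_0_iff)
  also have "vertex_degree E i \<le> vol E UNIV"
    unfolding vol_def by (rule member_le_sum) auto
  finally show ?thesis .
qed

text \<open>Positivity of the denominator of the quotient in the last part of the theorem.\<close>

lemma quotient_denominator_pos:
  fixes x :: "real ^ 'n::finite"
  assumes "simple_graph E" and "E \<noteq> {}" and "x \<noteq> 0"
  shows "0 < 2 * real (vol E UNIV) * infnorm x - median_deviation E x"
proof -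
  have "median_deviation E x \<le> (\<Sum>i\<in>UNIV. real (vertex_degree E i) * \<bar>x $ i - 0\<bar>)"
    using median_deviation_attained by blast
  also have "\<dots> \<le> (\<Sum>i\<in>UNIV. real (vertex_degree E i) * infnorm x)"
    by (intro sum_mono mult_left_mono) (simp_all add: component_le_infnorm_cart)
  also have "\<dots> = real (vol E UNIV) * infnorm x"
    by (simp add: vol_def sum_distrib_right)
  also have "\<dots> < 2 * real (vol E UNIV) * infnorm x"
    using vol_UNIV_pos[OF assms(1,2)] assms(3) by (simp add: infnorm_pos_lt)
  finally show ?thesis by simp
qed

text \<open>The halved sum over ordered pairs is the sum over edges.\<close>

lemma total_variation_edges:
  fixes x :: "real ^ 'n::finite"
  assumes "simple_graph E"
  shows "total_variation E x =
    (\<Sum>e\<in>E. THE r. \<exists>i j. e = {i, j} \<and> r = \<bar>x $ i - x $ j\<bar>)"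
proof -
  define w where "w e = (THE r. \<exists>i j. e = {i, j} \<and> r = \<bar>x $ i - x $ j\<bar>)" for e
  have w: "w {i, j} = \<bar>x $ i - x $ j\<bar>" for i j
    unfolding w_def by (rule the_equality) (auto simp: doubleton_eq_iff abs_minus_commute)
  define P where "P e = {p. {fst p, snd p} = e}" for e :: "'n set"
  have two: "(\<Sum>(i, j)\<in>P e. \<bar>x $ i - x $ j\<bar>) = 2 * w e" if "e \<in> E" for e
  proof -
    have "card e = 2"
      using assms that by (simp add: simple_graph_def)
    then obtain a b where ab: "e = {a, b}" "a \<noteq> b"
      by (auto simp: card_2_iff)
    have "P e = {(a, b), (b, a)}"
      unfolding P_def ab by (auto simp: doubleton_eq_iff)
    then have "(\<Sum>(i, j)\<in>P e. \<bar>x $ i - x $ j\<bar>) = \<bar>x $ a - x $ b\<bar> + \<bar>x $ b - x $ a\<bar>"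
      using ab(2) by simp
    also have "\<dots> = 2 * w e"
      unfolding ab(1) w by simp
    finally show ?thesis .
  qed
  have un: "{(i, j). {i, j} \<in> E} = (\<Union>e\<in>E. P e)"
    unfolding P_def by auto
  have "(\<Sum>(i, j) | {i, j} \<in> E. \<bar>x $ i - x $ j\<bar>) =
      (\<Sum>e\<in>E. \<Sum>(i, j)\<in>P e. \<bar>x $ i - x $ j\<bar>)"
    unfolding un by (rule sum.UNION_disjoint) (auto simp: P_def)
  also have "\<dots> = (\<Sum>e\<in>E. 2 * w e)"
    using two by (intro sum.cong) auto
  finally show ?thesis
    by (simp add: total_variation_def w_def sum_distrib_left[symmetric])
qed

end

theory Submission
  imports Defs
begin

text \<open>The functions \<open>infnorm\<close> and \<open>median_deviation E\<close> are positively homogeneous, so a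
  subgradient \<open>g\<close> at \<open>x\<close> satisfies \<open>g \<bullet> x = f x\<close>; pairing the eigenvalue equation with \<open>x\<close>
  gives the quotient, and \<open>I(x) \<le> N(x) \<le> vol(V) \<parallel>x\<parallel>\<close> bounds it by 1.
  All three subdifferentials at \<open>x\<close> can only grow when a monotone function is applied to the
  components of \<open>x\<close>, provided that it has values in \<open>[-1, 1]\<close> and sends \<open>\<plusminus>\<parallel>x\<parallel>\<close> to \<open>\<plusminus>1\<close>. Hence
  \<open>\<mu>\<close> with the same three subgradients remains an eigenvalue for the two truncated vectors.
  So every eigenvalue is a ratio \<open>|\<partial>A| / max(vol A, vol (V - A))\<close>. Numerator and
  denominator have the same parity, so the cross difference of two such ratios is even, whence the
  factor 2 in the gap.\<close>

section \<open>Subgradients\<close>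

text \<open>The subgradient inequality at \<open>0\<close> gives
  \<open>g \<bullet> x \<ge> f x\<close>, and at \<open>2 *\<^sub>R x\<close> it gives the
  reverse.\<close>

lemma subdifferential_homogeneous_iff:
  fixes f :: "'a::real_inner \<Rightarrow> real"
  assumes hom: "\<And>c x. c \<ge> 0 \<Longrightarrow> f (c *\<^sub>R x) = c * f x"
  shows "g \<in> subdifferential f x \<longleftrightarrow> g \<bullet> x = f x \<and> (\<forall>y. g \<bullet> y \<le> f y)"
proof
  assume "g \<in> subdifferential f x"
  then have g: "f y \<ge> f x + g \<bullet> (y - x)" for y
    by (simp add: subdifferential_def)
  have "g \<bullet> x = f x"
    using g[of "0 *\<^sub>R x"] g[of "2 *\<^sub>R x"] hom[of 0 x] hom[of 2 x]
    by (simp add: inner_diff_right)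
  with g show "g \<bullet> x = f x \<and> (\<forall>y. g \<bullet> y \<le> f y)"
    by (simp add: inner_diff_right)
qed (simp add: subdifferential_def inner_diff_right)

lemma mult_le_abs_bound:
  fixes a b c :: real
  assumes "\<bar>a\<bar> \<le> c"
  shows "a * b \<le> c * \<bar>b\<bar>"
proof -
  have "a * b \<le> \<bar>a\<bar> * \<bar>b\<bar>"
    unfolding abs_mult[symmetric] by (rule abs_ge_self)
  also have "\<dots> \<le> c * \<bar>b\<bar>"
    using assms by (intro mult_right_mono) auto
  finally show ?thesis .
qed

section \<open>Subgradients of the sup norm\<close>

lemma infnorm_le_cart:
  fixes x :: "real ^ 'n::finite"
  assumes "\<And>i. \<bar>x $ i\<bar> \<le> B"
  shows "infnorm x \<le> B"
  unfolding infnorm_cart using assms by (intro cSup_least) auto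

lemma infnorm_attained_cart:
  fixes x :: "real ^ 'n::finite"
  shows "\<exists>k. \<bar>x $ k\<bar> = infnorm x"
proof -
  have "infnorm x = Max (range (\<lambda>i. \<bar>x $ i\<bar>))"
    unfolding infnorm_cart by (subst cSup_eq_Max) (auto simp: full_SetCompr_eq)
  moreover have "Max (range (\<lambda>i. \<bar>x $ i\<bar>)) \<in> range (\<lambda>i. \<bar>x $ i\<bar>)"
    by (intro Max_in) auto
  ultimately show ?thesis by force
qed

text \<open>The dual of the sup norm is the sum norm. The sign vector of \<open>g\<close> tests one
  direction; Hoelder's inequality gives the other.\<close>

lemma infnorm_subgradient_iff:
  fixes g x :: "real ^ 'n::finite"
  shows "g \<in> subdifferential infnorm x \<longleftrightarrow> (\<Sum>i\<in>UNIV. \<bar>g $ i\<bar>) \<le> 1 \<and> g \<bullet> x = infnorm x"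
proof -
  have "(\<forall>y. g \<bullet> y \<le> infnorm y) \<longleftrightarrow> (\<Sum>i\<in>UNIV. \<bar>g $ i\<bar>) \<le> 1"
  proof
    assume "\<forall>y. g \<bullet> y \<le> infnorm y"
    then have "g \<bullet> (\<chi> i. sgn (g $ i)) \<le> infnorm (\<chi> i. sgn (g $ i))" by blast
    also have "\<dots> \<le> 1" by (rule infnorm_le_cart) (simp add: sgn_if)
    finally show "(\<Sum>i\<in>UNIV. \<bar>g $ i\<bar>) \<le> 1"
      by (simp add: inner_vec_def abs_sgn)
  next
    assume le: "(\<Sum>i\<in>UNIV. \<bar>g $ i\<bar>) \<le> 1"
    show "\<forall>y. g \<bullet> y \<le> infnorm y"
    proof
      fix y :: "real ^ 'n"
      have "g \<bullet> y \<le> (\<Sum>i\<in>UNIV. \<bar>g $ i\<bar> * infnorm y)"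
        unfolding inner_vec_def
      proof (rule sum_mono)
        fix i
        have "g $ i * y $ i \<le> \<bar>g $ i\<bar> * \<bar>y $ i\<bar>"
          by (rule mult_le_abs_bound) simp
        also have "\<dots> \<le> \<bar>g $ i\<bar> * infnorm y"
          by (intro mult_left_mono component_le_infnorm_cart) simp
        finally show "g $ i \<bullet> y $ i \<le> \<bar>g $ i\<bar> * infnorm y" by simp
      qed
      also have "\<dots> \<le> infnorm y"
        using mult_right_mono[OF le infnorm_pos_le[of y]] by (simp add: sum_distrib_right)
      finally show "g \<bullet> y \<le> infnorm y" .
    qed
  qed
  then show ?thesis
    by (subst subdifferential_homogeneous_iff) (auto simp: infnorm_mul)
qed

text \<open>The equality case of Hoelder's inequality: the total
  \<open>g \<bullet> x = infnorm x\<close> leaves no slack in any term. Hence \<open>g\<close> lives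
  on the coordinates where \<open>x\<close> attains its norm, and has the sign of \<open>x\<close>
  there.\<close>

lemma infnorm_subgradient_component:
  fixes g x :: "real ^ 'n::finite"
  assumes g: "g \<in> subdifferential infnorm x" and x: "x \<noteq> 0"
  shows "g $ i * x $ i = \<bar>g $ i\<bar> * infnorm x" and "(\<Sum>i\<in>UNIV. \<bar>g $ i\<bar>) = 1"
proof -
  have pos: "infnorm x > 0" using x by (simp add: infnorm_pos_lt)
  have le: "(\<Sum>i\<in>UNIV. \<bar>g $ i\<bar>) \<le> 1" and eq: "(\<Sum>i\<in>UNIV. g $ i * x $ i) = infnorm x"
    using g by (auto simp: infnorm_subgradient_iff inner_vec_def)
  have comp: "g $ i * x $ i \<le> \<bar>g $ i\<bar> * infnorm x" for i
    using mult_le_abs_bound[OF order_refl, of "g $ i" "x $ i"]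
      mult_left_mono[OF component_le_infnorm_cart[of x i] abs_ge_zero[of "g $ i"]]
    by (rule order_trans)
  have "infnorm x \<le> (\<Sum>i\<in>UNIV. \<bar>g $ i\<bar> * infnorm x)"
    by (subst eq[symmetric]) (intro sum_mono comp)
  then have "1 * infnorm x \<le> (\<Sum>i\<in>UNIV. \<bar>g $ i\<bar>) * infnorm x"
    by (simp only: sum_distrib_right mult_1)
  then have "1 \<le> (\<Sum>i\<in>UNIV. \<bar>g $ i\<bar>)"
    using pos by (rule mult_right_le_imp_le)
  with le show one: "(\<Sum>i\<in>UNIV. \<bar>g $ i\<bar>) = 1"
    by (rule order_antisym)
  have "(\<Sum>i\<in>UNIV. \<bar>g $ i\<bar> * infnorm x - g $ i * x $ i) =
      (\<Sum>i\<in>UNIV. \<bar>g $ i\<bar>) * infnorm x - (\<Sum>i\<in>UNIV. g $ i * x $ i)"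
    by (simp only: sum_subtractf sum_distrib_right)
  also have "\<dots> = 0"
    unfolding one eq by simp
  finally have "(\<Sum>i\<in>UNIV. \<bar>g $ i\<bar> * infnorm x - g $ i * x $ i) = 0" .
  then have "\<forall>i\<in>UNIV. \<bar>g $ i\<bar> * infnorm x - g $ i * x $ i = 0"
    using comp by (subst (asm) sum_nonneg_eq_0_iff) auto
  then show "g $ i * x $ i = \<bar>g $ i\<bar> * infnorm x" by simp
qed

section \<open>Subgradients of the median deviation\<close>

lemma median_deviation_le:
  "median_deviation E x \<le> (\<Sum>i\<in>UNIV. real (vertex_degree E i) * \<bar>x $ i - t\<bar>)"
  using median_deviation_attained by blast

text \<open>Scaling a minimizing \<open>t\<close> by \<open>c\<close> gives one inequality. For
  \<open>c > 0\<close> the other is the same inequality with factor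
  \<open>inverse c\<close>.\<close>

lemma median_deviation_scale:
  assumes "c \<ge> 0"
  shows "median_deviation E (c *\<^sub>R x) = c * median_deviation E x"
proof -
  have le: "median_deviation E (c *\<^sub>R x) \<le> c * median_deviation E x"
    if c: "c \<ge> 0" for c :: real and x :: "real ^ 'a"
  proof -
    obtain t where t: "median_deviation E x = (\<Sum>i\<in>UNIV. real (vertex_degree E i) * \<bar>x $ i - t\<bar>)"
      using median_deviation_attained by blast
    have "\<bar>(c *\<^sub>R x) $ i - c * t\<bar> = c * \<bar>x $ i - t\<bar>" for i
      using c by (simp add: abs_mult flip: right_diff_distrib)
    then show ?thesis
      using median_deviation_le[of E "c *\<^sub>R x" "c * t"] unfolding t
      by (simp add: sum_distrib_left mult.left_commute)
  qed
  have nonneg: "median_deviation E y \<ge> 0" for y :: "real ^ 'a"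
    using median_deviation_attained[of E y] by (metis (no_types, lifting) abs_ge_zero
      mult_nonneg_nonneg of_nat_0_le_iff sum_nonneg)
  show ?thesis
  proof (cases "c = 0")
    case True
    then show ?thesis using le[of 0 x] nonneg[of "0"] by simp
  next
    case False
    then have "median_deviation E x \<le> inverse c * median_deviation E (c *\<^sub>R x)"
      using le[of "inverse c" "c *\<^sub>R x"] assms by simp
    then have "c * median_deviation E x \<le> median_deviation E (c *\<^sub>R x)"
      using False assms by (simp add: field_simps)
    then show ?thesis using le[OF assms, of x] by simp
  qed
qed

text \<open>The zero sum is dual to the invariance of \<open>median_deviation E\<close> under adding
  constants, and the degree bounds come from coordinate vectors. The last clause is complementary
  slackness: summed over \<open>i\<close>, it says that \<open>v \<bullet> x\<close> equals the
  objective at \<open>t\<close>, so \<open>t\<close> is a weighted median of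
  \<open>x\<close>.\<close>

lemma median_subgradient_iff:
  fixes v x :: "real ^ 'n::finite"
  shows "v \<in> subdifferential (median_deviation E) x \<longleftrightarrow>
    (\<Sum>i\<in>UNIV. v $ i) = 0 \<and> (\<forall>i. \<bar>v $ i\<bar> \<le> real (vertex_degree E i)) \<and>
    (\<exists>t. \<forall>i. v $ i * (x $ i - t) = real (vertex_degree E i) * \<bar>x $ i - t\<bar>)"
    (is "_ \<longleftrightarrow> ?rhs")
proof -
  let ?d = "\<lambda>i. real (vertex_degree E i)"
  have "v \<in> subdifferential (median_deviation E) x \<longleftrightarrow>
      v \<bullet> x = median_deviation E x \<and> (\<forall>y. v \<bullet> y \<le> median_deviation E y)"
    by (rule subdifferential_homogeneous_iff) (rule median_deviation_scale)
  also have "\<dots> \<longleftrightarrow> ?rhs"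
  proof
    assume asm: "v \<bullet> x = median_deviation E x \<and> (\<forall>y. v \<bullet> y \<le> median_deviation E y)"
    have le: "v \<bullet> y \<le> (\<Sum>i\<in>UNIV. ?d i * \<bar>y $ i - t\<bar>)" for y t
      using asm median_deviation_le order_trans by blast
    \<comment> \<open>A constant vector has deviation 0 from its own value, so both signs of the sum
      are bounded by 0.\<close>
    have zero: "(\<Sum>i\<in>UNIV. v $ i) = 0"
      using le[of "\<chi> i. 1" 1] le[of "\<chi> i. -1" "-1"] by (simp add: inner_vec_def sum_negf)
    have abs: "\<bar>v $ i\<bar> \<le> ?d i" for i
    proof -
      have "v \<bullet> axis i c \<le> ?d i * \<bar>c\<bar>" for c
      proof -
        have "(\<Sum>j\<in>UNIV. ?d j * \<bar>axis i c $ j\<bar>) = (\<Sum>j\<in>UNIV. if j = i then ?d i * \<bar>c\<bar> else 0)"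
          by (intro sum.cong) (auto simp: axis_def)
        then show ?thesis using le[of "axis i c" 0] by simp
      qed
      from this[of 1] this[of "-1"] show ?thesis
        by (auto simp: inner_axis abs_le_iff)
    qed
    obtain t where t: "median_deviation E x = (\<Sum>i\<in>UNIV. ?d i * \<bar>x $ i - t\<bar>)"
      using median_deviation_attained by blast
    have "(\<Sum>i\<in>UNIV. ?d i * \<bar>x $ i - t\<bar> - v $ i * (x $ i - t)) = 0"
      using asm t zero
      by (simp add: inner_vec_def sum_subtractf right_diff_distrib flip: sum_distrib_right)
    moreover have "v $ i * (x $ i - t) \<le> ?d i * \<bar>x $ i - t\<bar>" for i
      using abs by (rule mult_le_abs_bound)
    ultimately have "\<forall>i\<in>UNIV. ?d i * \<bar>x $ i - t\<bar> - v $ i * (x $ i - t) = 0"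
      by (subst (asm) sum_nonneg_eq_0_iff) auto
    then have "\<forall>i. v $ i * (x $ i - t) = ?d i * \<bar>x $ i - t\<bar>" by simp
    then show ?rhs using zero abs by blast
  next
    assume r: ?rhs
    then obtain t where t: "\<And>i. v $ i * (x $ i - t) = ?d i * \<bar>x $ i - t\<bar>" by blast
    \<comment> \<open>Since \<open>v\<close> sums to 0, pairing with \<open>v\<close> ignores
      constant shifts, and each \<open>y\<close> may be centred at its own minimizer.\<close>
    have shift: "v \<bullet> y = (\<Sum>i\<in>UNIV. v $ i * (y $ i - s))" for y s
      using r by (simp add: inner_vec_def sum_subtractf right_diff_distrib flip: sum_distrib_right)
    have le: "v \<bullet> y \<le> median_deviation E y" for y
    proof -
      obtain s where s: "median_deviation E y = (\<Sum>i\<in>UNIV. ?d i * \<bar>y $ i - s\<bar>)"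
        using median_deviation_attained by blast
      have "v $ i * (y $ i - s) \<le> ?d i * \<bar>y $ i - s\<bar>" for i
        using r by (intro mult_le_abs_bound) blast
      then show ?thesis unfolding s shift[of y s] by (intro sum_mono)
    qed
    moreover have "median_deviation E x \<le> v \<bullet> x"
      using median_deviation_le[of E x t] by (simp add: shift[of x t] t)
    ultimately show "v \<bullet> x = median_deviation E x \<and> (\<forall>y. v \<bullet> y \<le> median_deviation E y)"
      by (auto intro: order_antisym)
  qed
  finally show ?thesis .
qed

section \<open>Double counting of edges\<close>

lemma edge_sum_swap:
  "(\<Sum>i\<in>UNIV. \<Sum>j | {i, j} \<in> E. f i j) = (\<Sum>i\<in>UNIV. \<Sum>j | {i, j} \<in> E. f j i)"
  for E :: "'n::finite set set" and f :: "'n \<Rightarrow> 'n \<Rightarrow> real"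
  using sum.swap_restrict[of UNIV UNIV f "\<lambda>i j. {i, j} \<in> E"] by (simp add: insert_commute)

lemma total_variation_eq:
  "2 * total_variation E x = (\<Sum>i\<in>UNIV. \<Sum>j | {i, j} \<in> E. \<bar>x $ i - x $ j\<bar>)"
proof -
  have "{(i, j). {i, j} \<in> E} = (SIGMA i:UNIV. {j. {i, j} \<in> E})" by auto
  then show ?thesis
    unfolding total_variation_def by (simp add: sum.Sigma)
qed

text \<open>Antisymmetry joins the two orientations of an edge into
  \<open>z i j * (x $ i - x $ j)\<close>, which is the absolute difference by the choice of
  \<open>z i j\<close> in \<open>Sgn\<close>.\<close>

lemma Laplacian1_inner:
  assumes "u \<in> Laplacian1 E x"
  shows "u \<bullet> x = total_variation E x"
proof -
  obtain z where u: "u = (\<chi> i. \<Sum>j | {i, j} \<in> E. z i j)"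
    and z: "\<And>i j. {i, j} \<in> E \<Longrightarrow> z i j \<in> Sgn (x $ i - x $ j) \<and> z i j = - z j i"
    using assms unfolding Laplacian1_def by blast
  have S: "u \<bullet> x = (\<Sum>i\<in>UNIV. \<Sum>j | {i, j} \<in> E. z i j * x $ i)"
    by (simp add: u inner_vec_def sum_distrib_right)
  also have "\<dots> = (\<Sum>i\<in>UNIV. \<Sum>j | {i, j} \<in> E. z j i * x $ j)"
    by (rule edge_sum_swap)
  finally have "2 * (u \<bullet> x) = (\<Sum>i\<in>UNIV. \<Sum>j | {i, j} \<in> E. z i j * x $ i + z j i * x $ j)"
    using S by (simp add: sum.distrib)
  also have "\<dots> = (\<Sum>i\<in>UNIV. \<Sum>j | {i, j} \<in> E. \<bar>x $ i - x $ j\<bar>)"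
  proof (intro sum.cong refl)
    fix i j assume "j \<in> {j. {i, j} \<in> E}"
    then have "z i j \<in> Sgn (x $ i - x $ j)" "z j i = - z i j"
      using z[of i j] by auto
    then show "z i j * x $ i + z j i * x $ j = \<bar>x $ i - x $ j\<bar>"
      by (auto simp: Sgn_def split: if_splits)
  qed
  finally show ?thesis using total_variation_eq[of E x] by simp
qed

text \<open>On each edge the triangle inequality passes through a median \<open>t\<close>; every
  vertex is then charged once for each incident edge.\<close>

lemma total_variation_le_median_deviation: "total_variation E x \<le> median_deviation E x"
proof -
  obtain t where t: "median_deviation E x = (\<Sum>i\<in>UNIV. real (vertex_degree E i) * \<bar>x $ i - t\<bar>)"
    using median_deviation_attained by blast
  have "2 * total_variation E x \<le> (\<Sum>i\<in>UNIV. \<Sum>j | {i, j} \<in> E. \<bar>x $ i - t\<bar> + \<bar>x $ j - t\<bar>)"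
    unfolding total_variation_eq by (intro sum_mono) linarith
  also have "\<dots> = 2 * (\<Sum>i\<in>UNIV. \<Sum>j | {i, j} \<in> E. \<bar>x $ i - t\<bar>)"
    using edge_sum_swap[of "\<lambda>i j. \<bar>x $ i - t\<bar>" E] by (simp add: sum.distrib)
  also have "\<dots> = 2 * median_deviation E x"
    by (simp add: t vertex_degree_def)
  finally show ?thesis by simp
qed

section \<open>Boundary edges and parity\<close>

definition outer_degree :: "'n::finite set set \<Rightarrow> 'n set \<Rightarrow> 'n \<Rightarrow> nat" where
  "outer_degree E A i = card {j. {i, j} \<in> E \<and> j \<notin> A}"

text \<open>Each boundary edge has exactly one orientation that leaves \<open>A\<close>, so edges
  correspond to ordered pairs.\<close>

lemma card_edge_boundary: "card (edge_boundary E A) = (\<Sum>i\<in>A. outer_degree E A i)"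
proof -
  let ?S = "SIGMA i:A. {j. {i, j} \<in> E \<and> j \<notin> A}"
  have "inj_on (\<lambda>(i, j). {i, j}) ?S"
    by (auto simp: inj_on_def doubleton_eq_iff)
  moreover have "edge_boundary E A = (\<lambda>(i, j). {i, j}) ` ?S"
    unfolding edge_boundary_def by auto
  ultimately have "card (edge_boundary E A) = card ?S"
    by (simp add: card_image)
  also have "\<dots> = (\<Sum>i\<in>A. outer_degree E A i)"
    by (simp add: outer_degree_def)
  finally show ?thesis .
qed

lemma edge_boundary_Compl: "edge_boundary E (- A) = edge_boundary E A"
proof -
  have "(\<exists>i j. e = {i, j} \<and> i \<in> - A \<and> j \<notin> - A) \<longleftrightarrow> (\<exists>i j. e = {i, j} \<and> i \<in> A \<and> j \<notin> A)" for e
    by (metis ComplD ComplI insert_commute)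
  then show ?thesis by (simp add: edge_boundary_def)
qed

lemma vol_Compl: "vol E A + vol E (- A) = vol E UNIV"
  unfolding vol_def by (subst sum.union_disjoint[symmetric]) auto

text \<open>There are no loops, so each edge inside \<open>A\<close> contributes exactly two ordered
  pairs.\<close>

lemma even_card_inner_pairs:
  assumes "simple_graph E"
  shows "even (card {(i, j). i \<in> A \<and> j \<in> A \<and> {i, j} \<in> E})"
proof -
  define P where "P e = {(i, j). {i, j} = e}" for e :: "'a set"
  have two: "card (P e) = 2" if "e \<in> E" for e
  proof -
    have "card e = 2"
      using assms that by (simp add: simple_graph_def)
    then obtain a b where ab: "e = {a, b}" "a \<noteq> b"
      by (auto simp: card_2_iff)
    then have "P e = {(a, b), (b, a)}"
      unfolding P_def by (auto simp: doubleton_eq_iff)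
    then show ?thesis using ab by simp
  qed
  have "{(i, j). i \<in> A \<and> j \<in> A \<and> {i, j} \<in> E} = (\<Union>e\<in>{e \<in> E. e \<subseteq> A}. P e)"
    unfolding P_def by auto
  also have "card \<dots> = (\<Sum>e\<in>{e \<in> E. e \<subseteq> A}. card (P e))"
    by (rule card_UN_disjoint) (auto simp: P_def)
  also have "\<dots> = 2 * card {e \<in> E. e \<subseteq> A}"
    using two by simp
  finally show ?thesis by simp
qed

text \<open>The volume of \<open>A\<close> counts each boundary edge once and each edge inside
  \<open>A\<close> twice.\<close>

lemma even_edge_boundary_iff:
  assumes "simple_graph E"
  shows "even (card (edge_boundary E A)) \<longleftrightarrow> even (vol E A)"
proof -
  have "vertex_degree E i = outer_degree E A i + card {j \<in> A. {i, j} \<in> E}" for i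
    unfolding vertex_degree_def outer_degree_def
    by (subst card_Un_disjoint[symmetric]) (auto intro: arg_cong[where f = card])
  then have "vol E A = card (edge_boundary E A) + (\<Sum>i\<in>A. card {j \<in> A. {i, j} \<in> E})"
    by (simp add: vol_def card_edge_boundary sum.distrib)
  also have "(\<Sum>i\<in>A. card {j \<in> A. {i, j} \<in> E}) = card (SIGMA i:A. {j \<in> A. {i, j} \<in> E})"
    by simp
  also have "(SIGMA i:A. {j \<in> A. {i, j} \<in> E}) = {(i, j). i \<in> A \<and> j \<in> A \<and> {i, j} \<in> E}"
    by auto
  finally show ?thesis
    using even_card_inner_pairs[OF assms, of A] by simp
qed

section \<open>Eigenpairs\<close>

lemma AC_eigenpair_iff:
  "AC_eigenpair E \<mu> x \<longleftrightarrow> x \<noteq> 0 \<and> (\<exists>u s v.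
     u - (2 * \<mu> * real (vol E UNIV)) *\<^sub>R s + \<mu> *\<^sub>R v = 0 \<and>
     u \<in> Laplacian1 E x \<and> s \<in> subdifferential infnorm x \<and>
     v \<in> subdifferential (median_deviation E) x)"
  unfolding AC_eigenpair_def mem_Collect_eq by (simp only: eq_commute[of 0] conj_assoc)

lemma AC_eigenpair_total_variation:
  assumes "AC_eigenpair E \<mu> x"
  shows "total_variation E x = \<mu> * (2 * real (vol E UNIV) * infnorm x - median_deviation E x)"
proof -
  obtain u s v where eq: "u - (2 * \<mu> * real (vol E UNIV)) *\<^sub>R s + \<mu> *\<^sub>R v = 0"
    and u: "u \<in> Laplacian1 E x" and s: "s \<in> subdifferential infnorm x"
    and v: "v \<in> subdifferential (median_deviation E) x"
    using assms unfolding AC_eigenpair_iff by blast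
  have "u \<bullet> x = total_variation E x"
    using u by (rule Laplacian1_inner)
  moreover have "s \<bullet> x = infnorm x"
    using s by (simp add: infnorm_subgradient_iff)
  moreover have "v \<bullet> x = median_deviation E x"
    using v subdifferential_homogeneous_iff[of "median_deviation E", OF median_deviation_scale]
    by blast
  moreover have "(u - (2 * \<mu> * real (vol E UNIV)) *\<^sub>R s + \<mu> *\<^sub>R v) \<bullet> x = 0"
    unfolding eq by simp
  ultimately show ?thesis
    by (simp add: inner_diff_left inner_add_left algebra_simps)
qed

lemma AC_eigenpair_quotient:
  assumes "simple_graph E" "E \<noteq> {}" "AC_eigenpair E \<mu> x"
  shows "total_variation E x / (2 * real (vol E UNIV) * infnorm x - median_deviation E x) = \<mu>"
proof -
  have "x \<noteq> 0" using assms(3) by (simp add: AC_eigenpair_def)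
  from quotient_denominator_pos[OF assms(1,2) this] show ?thesis
    using AC_eigenpair_total_variation[OF assms(3)] by simp
qed

lemma AC_eigenvalue_range:
  assumes "simple_graph E" "E \<noteq> {}" "AC_eigenpair E \<mu> x"
  shows "0 \<le> \<mu>" "\<mu> \<le> 1"
proof -
  have "x \<noteq> 0" using assms(3) by (simp add: AC_eigenpair_def)
  note pos = quotient_denominator_pos[OF assms(1,2) this]
  have "0 \<le> total_variation E x"
    unfolding total_variation_def by (intro divide_nonneg_nonneg sum_nonneg) auto
  then show "0 \<le> \<mu>"
    using pos unfolding AC_eigenpair_quotient[OF assms, symmetric] by simp
  have "median_deviation E x \<le> (\<Sum>i\<in>UNIV. real (vertex_degree E i) * infnorm x)"
    using median_deviation_le[of E x 0]
    by (rule order_trans) (intro sum_mono mult_left_mono, simp_all add: component_le_infnorm_cart)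
  also have "\<dots> = real (vol E UNIV) * infnorm x"
    by (simp add: vol_def sum_distrib_right)
  \<comment> \<open>With I, N and M for the total variation, the median deviation and the volume
    times the norm, I \<le> N \<le> M gives I + N \<le> 2M.\<close>
  finally have "total_variation E x \<le> 2 * real (vol E UNIV) * infnorm x - median_deviation E x"
    using total_variation_le_median_deviation[of E x] by linarith
  then show "\<mu> \<le> 1"
    using pos unfolding AC_eigenpair_quotient[OF assms, symmetric] by simp
qed

text \<open>A monotone map either keeps the sign of a difference or collapses it to 0, and
  \<open>Sgn 0\<close> contains every other value of \<open>Sgn\<close>. The same \<open>z\<close>
  therefore still serves.\<close>

lemma Laplacian1_mono:
  assumes "mono \<phi>" "u \<in> Laplacian1 E x"
  shows "u \<in> Laplacian1 E (\<chi> i. \<phi> (x $ i))"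
proof -
  have "Sgn (a - b) \<subseteq> Sgn (\<phi> a - \<phi> b)" for a b
    using monoD[OF assms(1), of a b] monoD[OF assms(1), of b a] by (auto simp: Sgn_def)
  then show ?thesis
    using assms(2) unfolding Laplacian1_def by (simp add: subset_iff) blast
qed

text \<open>Away from \<open>t\<close>, slackness fixes \<open>v $ i\<close> as plus or minus the
  degree, according to the side of \<open>t\<close>. Monotonicity keeps each component weakly on its
  side, so \<open>\<phi> t\<close> is the new witness.\<close>

lemma median_subgradient_mono:
  assumes "mono \<phi>" "v \<in> subdifferential (median_deviation E) x"
  shows "v \<in> subdifferential (median_deviation E) (\<chi> i. \<phi> (x $ i))"
proof -
  let ?d = "\<lambda>i. real (vertex_degree E i)"
  obtain t where t: "\<And>i. v $ i * (x $ i - t) = ?d i * \<bar>x $ i - t\<bar>"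
    using assms(2) by (auto simp: median_subgradient_iff)
  have "v $ i * (\<phi> (x $ i) - \<phi> t) = ?d i * \<bar>\<phi> (x $ i) - \<phi> t\<bar>" for i
  proof (cases "x $ i" t rule: linorder_cases)
    case less
    then have "v $ i * (x $ i - t) = - ?d i * (x $ i - t)"
      using t[of i] less by (simp add: algebra_simps)
    then have "v $ i = - ?d i"
      using less by (simp only: mult_cancel_right) simp
    then show ?thesis using monoD[OF assms(1), of "x $ i" t] less by (simp add: algebra_simps)
  next
    case greater
    then have "v $ i = ?d i" using t[of i] by simp
    then show ?thesis using monoD[OF assms(1), of t "x $ i"] greater by simp
  qed simp
  then show ?thesis
    using assms(2) unfolding median_subgradient_iff by auto
qed

text \<open>The equation between \<open>u\<close>, \<open>s\<close> and \<open>v\<close> does not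
  mention \<open>x\<close>, so it is enough that each stays a subgradient. For \<open>s\<close> this
  holds because it is supported where \<open>x\<close> is plus or minus its norm, and there
  \<open>\<phi>\<close> takes the values 1 and -1, which are extreme for the new vector.\<close>

lemma AC_eigenpair_mono:
  assumes pair: "AC_eigenpair E \<mu> x" and "mono \<phi>"
    and le: "\<And>r. \<bar>\<phi> r\<bar> \<le> 1" and top: "\<phi> (infnorm x) = 1" and bot: "\<phi> (- infnorm x) = - 1"
  shows "AC_eigenpair E \<mu> (\<chi> i. \<phi> (x $ i))"
proof -
  let ?y = "\<chi> i. \<phi> (x $ i)"
  obtain u s v where x: "x \<noteq> 0" and eq: "u - (2 * \<mu> * real (vol E UNIV)) *\<^sub>R s + \<mu> *\<^sub>R v = 0"
    and u: "u \<in> Laplacian1 E x" and s: "s \<in> subdifferential infnorm x"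
    and v: "v \<in> subdifferential (median_deviation E) x"
    using pair unfolding AC_eigenpair_iff by blast
  obtain k where "\<bar>x $ k\<bar> = infnorm x"
    using infnorm_attained_cart by blast
  then have "x $ k = infnorm x \<or> x $ k = - infnorm x" by linarith
  then have "\<bar>?y $ k\<bar> = 1" using top bot by auto
  then have y1: "infnorm ?y = 1"
    using component_le_infnorm_cart[of ?y k] infnorm_le_cart[of ?y 1] le by (simp add: order_antisym)
  have "s $ i * \<phi> (x $ i) = \<bar>s $ i\<bar>" for i
  proof (cases "s $ i" "0 :: real" rule: linorder_cases)
    case less
    then have "s $ i * x $ i = s $ i * (- infnorm x)"
      using infnorm_subgradient_component(1)[OF s x, of i] by simp
    then show ?thesis using less bot by (metis abs_of_neg less_irrefl mult_cancel_left mult_minus1_right)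
  next
    case greater
    then have "x $ i = infnorm x"
      using infnorm_subgradient_component(1)[OF s x, of i] by simp
    then show ?thesis using greater top by simp
  qed simp
  then have "s \<in> subdifferential infnorm ?y"
    using infnorm_subgradient_component(2)[OF s x] y1
    by (simp add: infnorm_subgradient_iff inner_vec_def)
  moreover have "?y \<noteq> 0" using y1 by (metis infnorm_0 zero_neq_one)
  ultimately show ?thesis
    using eq Laplacian1_mono[OF assms(2) u] median_subgradient_mono[OF assms(2) v]
    unfolding AC_eigenpair_iff by blast
qed

lemma AC_eigenpair_ternary:
  assumes "AC_eigenpair E \<mu> x"
  shows "AC_eigenpair E \<mu> (ind_vec (D_plus x) - ind_vec (D_minus x))"
proof -
  define M where "M = infnorm x"
  have M: "M > 0"
    using assms by (simp add: M_def infnorm_pos_lt AC_eigenpair_def)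
  define \<phi> :: "real \<Rightarrow> real" where "\<phi> r = (if r \<ge> M then 1 else if r \<le> - M then -1 else 0)" for r
  have "AC_eigenpair E \<mu> (\<chi> i. \<phi> (x $ i))"
    by (rule AC_eigenpair_mono[OF assms]) (use M in \<open>auto simp: \<phi>_def mono_def M_def\<close>)
  moreover have "(\<chi> i. \<phi> (x $ i)) = ind_vec (D_plus x) - ind_vec (D_minus x)"
  proof (simp add: vec_eq_iff, intro allI)
    fix i
    show "\<phi> (x $ i) = ind_vec (D_plus x) $ i - ind_vec (D_minus x) $ i"
      using M component_le_infnorm_cart[of x i]
      by (auto simp: \<phi>_def ind_vec_def D_plus_def D_minus_def indicator_def M_def[symmetric])
  qed
  ultimately show ?thesis by simp
qed

lemma AC_eigenpair_binary:
  assumes "AC_eigenpair E \<mu> x"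
  shows "AC_eigenpair E \<mu> (ind_vec (D_plus x) - ind_vec (UNIV - D_plus x))"
proof -
  define M where "M = infnorm x"
  have M: "M > 0"
    using assms by (simp add: M_def infnorm_pos_lt AC_eigenpair_def)
  \<comment> \<open>Everything below the maximal possible value goes to -1. If
    \<open>D_plus x\<close> is empty, the result is the constant vector -1.\<close>
  define \<phi> :: "real \<Rightarrow> real" where "\<phi> r = (if r \<ge> M then 1 else -1)" for r
  have "AC_eigenpair E \<mu> (\<chi> i. \<phi> (x $ i))"
    by (rule AC_eigenpair_mono[OF assms]) (use M in \<open>auto simp: \<phi>_def mono_def M_def\<close>)
  moreover have "(\<chi> i. \<phi> (x $ i)) = ind_vec (D_plus x) - ind_vec (UNIV - D_plus x)"
  proof (simp add: vec_eq_iff, intro allI)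
    fix i
    show "\<phi> (x $ i) = ind_vec (D_plus x) $ i - ind_vec (UNIV - D_plus x) $ i"
      using M component_le_infnorm_cart[of x i]
      by (auto simp: \<phi>_def ind_vec_def D_plus_def indicator_def M_def[symmetric])
  qed
  ultimately show ?thesis by simp
qed

section \<open>Cuts\<close>

text \<open>The value of the quotient at the cut vector of \<open>A\<close>: the total variation is
  twice the boundary, the norm is 1, the median deviation is twice the smaller volume, and the total
  volume minus the smaller one is the larger one.\<close>

definition cut_ratio :: "'n::finite set set \<Rightarrow> 'n set \<Rightarrow> real" where
  "cut_ratio E A = real (card (edge_boundary E A)) / real (max (vol E A) (vol E (UNIV - A)))"

text \<open>Explicit subgradients \<open>u\<close> and \<open>v\<close> are chosen first. Solving
  the equation for \<open>s\<close> then yields a vector of sum norm 1 with the signs of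
  \<open>x\<close>, unless the ratio is 0.\<close>

lemma AC_eigenpair_cut:
  fixes E :: "'n::finite set set"
  assumes "simple_graph E" "E \<noteq> {}"
  shows "AC_eigenpair E (cut_ratio E A) (ind_vec A - ind_vec (UNIV - A))"
proof -
  define d where "d i = real (vertex_degree E i)" for i
  define x :: "real ^ 'n" where "x = (\<chi> i. if i \<in> A then 1 else -1)"
  have x_eq: "ind_vec A - ind_vec (UNIV - A) = x"
    by (simp add: vec_eq_iff x_def ind_vec_def)
  define a where "a = real (vol E A)"
  define b where "b = real (vol E (- A))"
  define p where "p = real (card (edge_boundary E A))"
  define \<mu> where "\<mu> = cut_ratio E A"
  have ab: "a + b = real (vol E UNIV)" "a + b > 0" "a \<ge> 0" "b \<ge> 0"
    using vol_Compl[of E A] vol_UNIV_pos[OF assms] by (simp_all add: a_def b_def flip: of_nat_add)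
  have \<mu>: "\<mu> = p / max a b"
    by (simp add: \<mu>_def cut_ratio_def p_def a_def b_def Compl_eq_Diff_UNIV of_nat_max)
  have \<mu>0: "\<mu> \<ge> 0" unfolding \<mu> using ab by (simp add: p_def)
  have max: "max a b > 0" using ab by linarith
  have p: "p = \<mu> * max a b" unfolding \<mu> using max by simp
  have split: "sum f UNIV = sum f A + sum f (- A)" for f :: "'n \<Rightarrow> real"
    by (subst sum.union_disjoint[symmetric]) auto
  \<comment> \<open>The number of edges from \<open>i\<close> to the other side; its sum over either
    side counts the whole boundary.\<close>
  define w where "w i = real (if i \<in> A then outer_degree E A i else outer_degree E (- A) i)" for i
  have w0: "w i \<ge> 0" for i by (simp add: w_def)
  have wA: "sum w A = p"
    by (simp add: w_def p_def card_edge_boundary)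
  have wB: "sum w (- A) = p"
    by (simp add: w_def p_def edge_boundary_Compl[of E A, symmetric] card_edge_boundary)
  txt \<open>The weights \<open>c\<close> make the components of \<open>v\<close> below sum to 0. If the side of \<open>i\<close> has
    volume 0, then \<open>c i = 0\<close>, since \<open>x / 0 = 0\<close>.\<close>
  define c where "c i = min a b / (if i \<in> A then a else b)" for i
  have c: "0 \<le> c i" "c i \<le> 1" for i
    using ab by (auto simp: c_def divide_le_eq_1 min_def)
  have dA: "sum d A = a" and dB: "sum d (- A) = b"
    by (simp_all add: d_def a_def b_def vol_def)
  have cA: "(\<Sum>i\<in>A. c i * d i) = min a b"
  proof -
    have "(\<Sum>i\<in>A. c i * d i) = min a b / a * sum d A"
      unfolding sum_distrib_left by (intro sum.cong) (auto simp: c_def)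
    then show ?thesis using ab by (auto simp: dA min_def)
  qed
  have cB: "(\<Sum>i\<in>- A. c i * d i) = min a b"
  proof -
    have "(\<Sum>i\<in>- A. c i * d i) = min a b / b * sum d (- A)"
      unfolding sum_distrib_left by (intro sum.cong) (auto simp: c_def)
    then show ?thesis using ab by (auto simp: dB min_def)
  qed
  define u where "u = (\<chi> i. x $ i * w i)"
  define v where "v = (\<chi> i. x $ i * (c i * d i))"
  have d0: "d i \<ge> 0" for i by (simp add: d_def)
  have v: "v \<in> subdifferential (median_deviation E) x"
    unfolding median_subgradient_iff d_def[symmetric]
  proof (intro conjI allI)
    show "(\<Sum>i\<in>UNIV. v $ i) = 0"
      unfolding split using cA cB by (simp add: v_def x_def sum_negf)
    show "\<bar>v $ i\<bar> \<le> d i" for i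
      using c[of i] d0[of i] by (simp add: v_def x_def mult_left_le_one_le)
    \<comment> \<open>On a side of volume 0 the weight \<open>c i\<close> is 0, and slackness holds
      there because all degrees vanish.\<close>
    have dz: "d i = 0" if "a = 0" "i \<in> A" for i
      using dA that d0 by (simp add: sum_nonneg_eq_0_iff)
    have dz': "d i = 0" if "b = 0" "i \<notin> A" for i
      using dB that d0 by (simp add: sum_nonneg_eq_0_iff)
    show "\<exists>t. \<forall>i. v $ i * (x $ i - t) = d i * \<bar>x $ i - t\<bar>"
    \<comment> \<open>The value of \<open>x\<close> on the heavier side is a weighted median. On the
      lighter side \<open>c\<close> is 1 if that side has positive volume, so \<open>v\<close> has
      full size there.\<close>
    proof (cases "a \<ge> b")
      case True
      then have "\<forall>i. v $ i * (x $ i - 1) = d i * \<bar>x $ i - 1\<bar>"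
        using dz' by (auto simp: v_def x_def c_def min_def)
      then show ?thesis by blast
    next
      case False
      then have "\<forall>i. v $ i * (x $ i - (-1)) = d i * \<bar>x $ i - (-1)\<bar>"
        using dz by (auto simp: v_def x_def c_def min_def)
      then show ?thesis by blast
    qed
  qed
  have u: "u \<in> Laplacian1 E x"
  proof -
    \<comment> \<open>Half the difference is 1 or -1 across the cut and 0 inside either side, where
      \<open>Sgn\<close> leaves the choice free.\<close>
    define z :: "'n \<Rightarrow> 'n \<Rightarrow> real" where "z i j = (x $ i - x $ j) / 2" for i j
    have "(\<Sum>j | {i, j} \<in> E. z i j) = u $ i" for i
    proof (cases "i \<in> A")
      case True
      then have "(\<Sum>j | {i, j} \<in> E. z i j) = (\<Sum>j | {i, j} \<in> E \<and> j \<notin> A. 1)"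
        by (intro sum.mono_neutral_cong_right) (auto simp: z_def x_def)
      then show ?thesis using True by (simp add: u_def x_def w_def outer_degree_def)
    next
      case False
      then have "(\<Sum>j | {i, j} \<in> E. z i j) = (\<Sum>j | {i, j} \<in> E \<and> j \<notin> - A. -1)"
        by (intro sum.mono_neutral_cong_right) (auto simp: z_def x_def)
      then show ?thesis using False by (simp add: u_def x_def w_def outer_degree_def)
    qed
    then have "u = (\<chi> i. \<Sum>j | {i, j} \<in> E. z i j)" by (simp add: vec_eq_iff)
    moreover have "z i j \<in> Sgn (x $ i - x $ j) \<and> z i j = - z j i" for i j
      by (auto simp: z_def x_def Sgn_def)
    ultimately show ?thesis unfolding Laplacian1_def by blast
  qed
  have x1: "infnorm x = 1"
  proof (rule order_antisym)
    show "infnorm x \<le> 1" by (rule infnorm_le_cart) (simp add: x_def)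
    show "1 \<le> infnorm x"
      \<comment> \<open>\<open>undefined\<close> is just some vertex; every component of
        \<open>x\<close> has absolute value 1.\<close>
      using component_le_infnorm_cart[of x undefined] by (simp add: x_def split: if_splits)
  qed
  obtain s where s: "s \<in> subdifferential infnorm x"
    and eq: "u - (2 * \<mu> * (a + b)) *\<^sub>R s + \<mu> *\<^sub>R v = 0"
  proof (cases "\<mu> = 0")
    \<comment> \<open>The boundary is empty, so \<open>u\<close> vanishes and the equation puts no
      constraint on \<open>s\<close>: any signed coordinate vector will do.\<close>
    case True
    then have "p = 0" using p by simp
    then have "w i = 0" for i
      using wA wB w0 by (cases "i \<in> A") (auto simp: sum_nonneg_eq_0_iff)
    then have "u = 0" by (simp add: u_def vec_eq_iff)
    moreover have "axis k (x $ k) \<in> subdifferential infnorm x" for k :: 'n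
    proof -
      have "(\<Sum>i\<in>UNIV. \<bar>axis k (x $ k) $ i\<bar>) = (\<Sum>i\<in>UNIV. if i = k then \<bar>x $ k\<bar> else 0)"
        by (intro sum.cong) (auto simp: axis_def)
      then show ?thesis
        unfolding infnorm_subgradient_iff x1 by (simp add: inner_axis' x_def)
    qed
    ultimately show ?thesis using True by (intro that) simp_all
  next
    case False
    then have pos: "2 * \<mu> * (a + b) > 0" using \<mu>0 ab by simp
    txt \<open>The equation determines \<open>s\<close> once \<open>u\<close> and \<open>v\<close> are chosen.\<close>
    define q where "q i = (w i + \<mu> * (c i * d i)) / (2 * \<mu> * (a + b))" for i
    define s where "s = (\<chi> i. x $ i * q i)"
    have q0: "q i \<ge> 0" for i
    proof -
      have "0 \<le> w i + \<mu> * (c i * d i)"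
        using w0 c d0 \<mu>0 by simp
      then show ?thesis using pos unfolding q_def by simp
    qed
    have "(\<Sum>i\<in>UNIV. w i + \<mu> * (c i * d i)) = sum w UNIV + \<mu> * (\<Sum>i\<in>UNIV. c i * d i)"
      by (simp only: sum.distrib sum_distrib_left)
    also have "\<dots> = 2 * p + 2 * \<mu> * min a b"
      using split[of w] split[of "\<lambda>i. c i * d i"] wA wB cA cB by simp
    finally have "sum q UNIV = (2 * p + 2 * \<mu> * min a b) / (2 * \<mu> * (a + b))"
      unfolding q_def sum_divide_distrib[symmetric] by (rule arg_cong)
    \<comment> \<open>Here the maximum in the denominator of the ratio matters:
      \<open>p = \<mu> * max a b\<close>, and the maximum and minimum add up to
      \<open>a + b\<close>.\<close>
    also have "2 * p + 2 * \<mu> * min a b = 2 * \<mu> * (a + b)"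
      unfolding p by (auto simp: max_def min_def algebra_simps)
    finally have "sum q UNIV = 1" using False ab(2) by simp
    moreover have "\<bar>s $ i\<bar> = q i" "s $ i * x $ i = q i" for i
      using q0[of i] by (auto simp: s_def x_def)
    ultimately have "s \<in> subdifferential infnorm x"
      by (simp add: infnorm_subgradient_iff x1 inner_vec_def)
    moreover have "u - (2 * \<mu> * (a + b)) *\<^sub>R s + \<mu> *\<^sub>R v = 0"
    proof (simp only: vec_eq_iff, intro allI)
      fix i
      have "2 * \<mu> * (a + b) * q i = w i + \<mu> * (c i * d i)"
        unfolding q_def using False ab(2) by simp
      then have "x $ i * (2 * \<mu> * (a + b) * q i) = x $ i * (w i + \<mu> * (c i * d i))" by simp
      then show "(u - (2 * \<mu> * (a + b)) *\<^sub>R s + \<mu> *\<^sub>R v) $ i = 0 $ i"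
        by (simp add: u_def s_def v_def algebra_simps)
    qed
    ultimately show ?thesis by (rule that)
  qed
  have "x \<noteq> 0" using x1 by (metis infnorm_0 zero_neq_one)
  then show ?thesis
    unfolding x_eq AC_eigenpair_iff \<mu>_def[symmetric] using eq[unfolded ab(1)] u s v
    by (intro conjI exI)
qed

text \<open>The binary truncation of an eigenvector is a cut vector, so it belongs both to
  \<open>\<mu>\<close> and to its cut ratio. By the quotient formula a vector has only one
  eigenvalue.\<close>

lemma AC_eigenvalue_cut_ratio:
  assumes "simple_graph E" "E \<noteq> {}" "AC_eigenvalue E \<mu>"
  shows "\<exists>A. \<mu> = cut_ratio E A"
proof -
  obtain x where x: "AC_eigenpair E \<mu> x"
    using assms(3) by (auto simp: AC_eigenvalue_def)
  have "\<mu> = cut_ratio E (D_plus x)"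
    using AC_eigenpair_quotient[OF assms(1,2) AC_eigenpair_binary[OF x]]
      AC_eigenpair_quotient[OF assms(1,2) AC_eigenpair_cut[OF assms(1,2), of "D_plus x"]]
    by (rule trans[OF sym])
  then show ?thesis ..
qed

section \<open>Separation and number of the eigenvalues\<close>

lemma cut_ratio_gap:
  assumes "simple_graph E" "E \<noteq> {}" "cut_ratio E A \<noteq> cut_ratio E B"
  shows "\<bar>cut_ratio E A - cut_ratio E B\<bar> \<ge> 2 / (real (vol E UNIV))\<^sup>2"
proof -
  \<comment> \<open>Integers are used because the cross difference \<open>k\<close> may be
    negative.\<close>
  define p where "p A = int (card (edge_boundary E A))" for A
  define q where "q A = int (max (vol E A) (vol E (UNIV - A)))" for A
  let ?V = "int (vol E UNIV)"
  have q: "0 < q A" "q A \<le> ?V" for A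
    using vol_Compl[of E A] vol_UNIV_pos[OF assms(1,2)] by (auto simp: q_def Compl_eq_Diff_UNIV)
  \<comment> \<open>The boundary has the parity of both volumes, hence of whichever is the
    maximum.\<close>
  have par: "even (p A) \<longleftrightarrow> even (q A)" for A
    using even_edge_boundary_iff[OF assms(1), of A] even_edge_boundary_iff[OF assms(1), of "- A"]
    unfolding edge_boundary_Compl by (simp add: p_def q_def max_def Compl_eq_Diff_UNIV)
  have r: "cut_ratio E A = of_int (p A) / of_int (q A)" for A
    by (simp add: cut_ratio_def p_def q_def)
  define k where "k = p A * q B - p B * q A"
  have diff: "cut_ratio E A - cut_ratio E B = of_int k / of_int (q A * q B)"
    unfolding r k_def using q(1)[of A] q(1)[of B] by (simp add: field_simps)
  have "k \<noteq> 0" using diff assms(3) by auto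
  \<comment> \<open>By \<open>par\<close>, each of the two products is odd exactly when
    \<open>q A\<close> and \<open>q B\<close> are both odd.\<close>
  moreover have "even k" unfolding k_def using par[of A] par[of B] by auto
  ultimately have k2: "\<bar>k\<bar> \<ge> 2" by presburger
  have "q A * q B \<le> ?V * ?V"
    using q[of A] q[of B] by (intro mult_mono) auto
  then have "real_of_int (q A * q B) \<le> real_of_int (?V * ?V)"
    by (simp only: of_int_le_iff)
  then have qq: "real_of_int (q A * q B) \<le> (real (vol E UNIV))\<^sup>2"
    by (simp add: power2_eq_square)
  have pos: "0 < real_of_int (q A * q B)" using q[of A] q[of B] by simp
  have "2 / (real (vol E UNIV))\<^sup>2 \<le> real_of_int \<bar>k\<bar> / real_of_int (q A * q B)"
    using k2 qq pos by (intro frac_le) auto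
  also have "\<dots> = \<bar>cut_ratio E A - cut_ratio E B\<bar>"
    unfolding diff using pos by simp
  finally show ?thesis .
qed

text \<open>Pigeonhole: a half-open cell of length \<open>\<delta>\<close> holds at most one point
  of \<open>S\<close>, and the floor numbers the cells.\<close>

lemma separated_card_le:
  fixes S :: "real set"
  assumes "\<delta> > 0" "S \<subseteq> {0..1}"
    and sep: "\<And>x y. x \<in> S \<Longrightarrow> y \<in> S \<Longrightarrow> x \<noteq> y \<Longrightarrow> \<bar>x - y\<bar> \<ge> \<delta>"
  shows "finite S" "real (card S) \<le> 1 / \<delta> + 1"
proof -
  define f where "f x = \<lfloor>x / \<delta>\<rfloor>" for x
  have inj: "inj_on f S"
  proof (rule inj_onI, rule ccontr)
    fix x y assume xy: "x \<in> S" "y \<in> S" "f x = f y" "x \<noteq> y"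
    then have "\<bar>x / \<delta> - y / \<delta>\<bar> < 1" unfolding f_def by linarith
    then have "\<bar>x - y\<bar> / \<delta> < 1" using assms(1) by (simp flip: diff_divide_distrib)
    then show False using sep[OF xy(1,2,4)] assms(1) by simp
  qed
  have "0 \<le> x / \<delta> \<and> x / \<delta> \<le> 1 / \<delta>" if "x \<in> S" for x
  proof -
    have "0 \<le> x" "x \<le> 1" using assms(2) that by auto
    then show ?thesis using assms(1) by (simp add: divide_right_mono)
  qed
  then have sub: "f ` S \<subseteq> {0..\<lfloor>1 / \<delta>\<rfloor>}"
    by (auto simp: f_def intro!: floor_mono)
  then show "finite S"
    using inj finite_imageD finite_subset finite_atLeastAtMost_int by blast
  \<comment> \<open>Numbering the cells from 0 accounts for the summand 1 in the bound.\<close>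
  have "card S \<le> card {0..\<lfloor>1 / \<delta>\<rfloor>}"
    using card_mono[OF finite_atLeastAtMost_int sub] card_image[OF inj] by simp
  then have "real (card S) \<le> real (nat (\<lfloor>1 / \<delta>\<rfloor> + 1))" by simp
  also have "\<dots> \<le> 1 / \<delta> + 1" using assms(1) by simp
  finally show "real (card S) \<le> 1 / \<delta> + 1" .
qed

theorem theorem5p3:
  fixes E :: "'n::finite set set"
  assumes "simple_graph E" and "E \<noteq> {}"
  shows
    "(\<forall>\<mu>. AC_eigenvalue E \<mu> \<longrightarrow> 0 \<le> \<mu> \<and> \<mu> \<le> 1)
     \<and>
     ((\<forall>\<mu> \<nu>. AC_eigenvalue E \<mu> \<and> AC_eigenvalue E \<nu> \<and> \<mu> \<noteq> \<nu>
          \<longrightarrow> \<bar>\<mu> - \<nu>\<bar> \<ge> 2 / (real (vol E UNIV))\<^sup>2)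
      \<and> finite {\<mu>. AC_eigenvalue E \<mu>}
      \<and> real (card {\<mu>. AC_eigenvalue E \<mu>}) \<le> (real (vol E UNIV))\<^sup>2 / 2 + 1)
     \<and>
     (\<forall>A. AC_eigenpair E
            (real (card (edge_boundary E A)) / real (max (vol E A) (vol E (UNIV - A))))
            (ind_vec A - ind_vec (UNIV - A)))
     \<and>
     (\<forall>\<mu> x. AC_eigenpair E \<mu> x \<longrightarrow>
        total_variation E x / (2 * real (vol E UNIV) * infnorm x - median_deviation E x) = \<mu>
        \<and> AC_eigenpair E \<mu> (ind_vec (D_plus x) - ind_vec (D_minus x))
        \<and> AC_eigenpair E \<mu> (ind_vec (D_plus x) - ind_vec (UNIV - D_plus x)))"
proof -
  let ?S = "{\<mu>. AC_eigenvalue E \<mu>}"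
  have range: "0 \<le> \<mu> \<and> \<mu> \<le> 1" if "AC_eigenvalue E \<mu>" for \<mu>
    using that AC_eigenvalue_range[OF assms] by (auto simp: AC_eigenvalue_def)
  have gap: "\<bar>\<mu> - \<nu>\<bar> \<ge> 2 / (real (vol E UNIV))\<^sup>2"
    if "AC_eigenvalue E \<mu>" "AC_eigenvalue E \<nu>" "\<mu> \<noteq> \<nu>" for \<mu> \<nu>
    using that AC_eigenvalue_cut_ratio[OF assms] cut_ratio_gap[OF assms] by metis
  have pos: "0 < 2 / (real (vol E UNIV))\<^sup>2"
    using vol_UNIV_pos[OF assms] by simp
  have "?S \<subseteq> {0..1}" using range by auto
  note count = separated_card_le[OF pos this]
  have fin: "finite ?S" using count(1) gap by simp
  have card: "real (card ?S) \<le> (real (vol E UNIV))\<^sup>2 / 2 + 1"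
    using count(2) gap by simp
  show ?thesis
    using range gap fin card AC_eigenpair_cut[OF assms, unfolded cut_ratio_def]
      AC_eigenpair_quotient[OF assms] AC_eigenpair_ternary AC_eigenpair_binary
    by blast
qed

end
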